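(* Let $A\in\mathcal{M}_n(\mathbb{C})$, $B\in\mathcal{M}_m(\mathbb{C})$, and for $i=1,\ldots,n$ let $C_i\in\mathcal{M}_n(\mathbb{C})$ be the matrix with entry $1$ in position $(i,i)$ and $0$ elsewhere. Put $$A_1=A,\quad A_2=C_1,\ \ldots,\ A_{n+1}=C_n$$ and $$B_1=I_m^{\otimes n},\qquad B_h=\left(I_m^{\otimes(h-2)}\otimes B\otimes I_m^{\otimes(n-h+1)}\right)^T\quad\text{for } h=2,\ldots,n+1.$$ Let $C\in\mathcal{M}_{n\times m^n}(\mathbb{C})$. Then the equation $\sum_{i=1}^{n+1}A_iXB_i=C$ in the unknown $X\in\mathcal{M}_{n\times m^n}(\mathbb{C})$ has a unique solution if and only if $A\wr B$ has full rank.
   Context: $n,m$ are positive integers. Wreath product of matrices: for $A\in\mathcal{M}_n(\mathbb{C})$ and $B\in\mathcal{M}_m(\mathbb{C})$, $$A\wr B = I_m^{\otimes n}\otimes A+\sum_{i=1}^n I_m^{\otimes (i-1)}\otimes B\otimes I_m^{\otimes (n-i)}\otimes C_i,$$ a square matrix of order $nm^n$. Here $\otimes$ is the Kronecker product and $I_m^{\otimes r}$ is the $r$-fold Kronecker power, with $I_m^{\otimes 0}=1$. *)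

theory Defs
  imports Complex_Main "Jordan_Normal_Form.Matrix" "Jordan_Normal_Form.DL_Rank"
begin

text \<open>Matrix entries are indexed from 0. The indices of the families of matrices below run from 1.\<close>

definition kronecker :: "complex mat \<Rightarrow> complex mat \<Rightarrow> complex mat" (infixl \<open>\<otimes>\<^sub>K\<close> 70) where
  "A \<otimes>\<^sub>K B = mat (dim_row A * dim_row B) (dim_col A * dim_col B)
     (\<lambda>(i, j). A $$ (i div dim_row B, j div dim_col B) * B $$ (i mod dim_row B, j mod dim_col B))"

primrec kronecker_power :: "complex mat \<Rightarrow> nat \<Rightarrow> complex mat" (infixr \<open>^\<^sub>K\<close> 80) where
  "A ^\<^sub>K 0 = 1\<^sub>m 1"
| "A ^\<^sub>K Suc r = A ^\<^sub>K r \<otimes>\<^sub>K A"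

definition diag_unit_mat :: "nat \<Rightarrow> nat \<Rightarrow> complex mat" where
  "diag_unit_mat n i = mat n n (\<lambda>(r, s). if r = i - 1 \<and> s = i - 1 then 1 else 0)"

definition wreath_mat :: "complex mat \<Rightarrow> complex mat \<Rightarrow> complex mat" where
  "wreath_mat A B = (let n = dim_row A; m = dim_row B; N = n * m ^ n in
     (1\<^sub>m m ^\<^sub>K n \<otimes>\<^sub>K A) +
     (\<Oplus>\<^bsub>module_mat TYPE(complex) N N\<^esub> i\<in>{1..n}.
        1\<^sub>m m ^\<^sub>K (i - 1) \<otimes>\<^sub>K B \<otimes>\<^sub>K 1\<^sub>m m ^\<^sub>K (n - i) \<otimes>\<^sub>K diag_unit_mat n i))"

definition left_coeff :: "complex mat \<Rightarrow> nat \<Rightarrow> complex mat" where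
  "left_coeff A h = (if h = 1 then A else diag_unit_mat (dim_row A) (h - 1))"

text \<open>The exponent \<open>n - h + 1\<close> is written \<open>n + 1 - h\<close>, as subtraction on \<^typ>\<open>nat\<close> truncates at
  \<open>h = n + 1\<close>.\<close>

definition right_coeff :: "nat \<Rightarrow> complex mat \<Rightarrow> nat \<Rightarrow> complex mat" where
  "right_coeff n B h = (let m = dim_row B in
     if h = 1 then 1\<^sub>m m ^\<^sub>K n
     else transpose_mat (1\<^sub>m m ^\<^sub>K (h - 2) \<otimes>\<^sub>K B \<otimes>\<^sub>K 1\<^sub>m m ^\<^sub>K (n + 1 - h)))"

lemma kronecker_carrier:
  "A \<in> carrier_mat a b \<Longrightarrow> B \<in> carrier_mat c d \<Longrightarrow> A \<otimes>\<^sub>K B \<in> carrier_mat (a * c) (b * d)"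
  by (auto simp: kronecker_def)

lemma kronecker_power_carrier:
  "A \<in> carrier_mat a b \<Longrightarrow> A ^\<^sub>K r \<in> carrier_mat (a ^ r) (b ^ r)"
proof (induction r)
  case (Suc r)
  then show ?case using kronecker_carrier[of "A ^\<^sub>K r" "a ^ r" "b ^ r" A a b]
    by (simp add: mult.commute)
qed simp

lemma sandwich_carrier:
  assumes B: "B \<in> carrier_mat m m"
  shows "1\<^sub>m m ^\<^sub>K p \<otimes>\<^sub>K B \<otimes>\<^sub>K 1\<^sub>m m ^\<^sub>K q \<in> carrier_mat (m ^ (p + 1 + q)) (m ^ (p + 1 + q))"
proof -
  have "m ^ (p + 1 + q) = m ^ p * m * m ^ q"
    by (simp add: power_add)
  moreover have "1\<^sub>m m ^\<^sub>K p \<otimes>\<^sub>K B \<otimes>\<^sub>K 1\<^sub>m m ^\<^sub>K q \<in> carrier_mat (m ^ p * m * m ^ q) (m ^ p * m * m ^ q)"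
    by (intro kronecker_carrier kronecker_power_carrier B one_carrier_mat)
  ultimately show ?thesis by metis
qed

text \<open>The summands of the two matrix sums lie in the carriers of the modules the sums are taken in;
  \<^const>\<open>finsum\<close> is meaningful only then.\<close>

lemma wreath_summand_carrier:
  assumes "B \<in> carrier_mat m m" "i \<in> {1..n}"
  shows "1\<^sub>m m ^\<^sub>K (i - 1) \<otimes>\<^sub>K B \<otimes>\<^sub>K 1\<^sub>m m ^\<^sub>K (n - i) \<otimes>\<^sub>K diag_unit_mat n i
           \<in> carrier_mat (n * m ^ n) (n * m ^ n)"
proof -
  have "i - 1 + 1 + (n - i) = n"
    using assms(2) by auto
  then have "1\<^sub>m m ^\<^sub>K (i - 1) \<otimes>\<^sub>K B \<otimes>\<^sub>K 1\<^sub>m m ^\<^sub>K (n - i) \<in> carrier_mat (m ^ n) (m ^ n)"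
    using sandwich_carrier[OF assms(1), of "i - 1" "n - i"] by metis
  moreover have "diag_unit_mat n i \<in> carrier_mat n n"
    by (simp add: diag_unit_mat_def)
  ultimately show ?thesis
    using kronecker_carrier by (metis mult.commute)
qed

lemma wreath_mat_carrier:
  assumes A: "A \<in> carrier_mat n n" and B: "B \<in> carrier_mat m m"
  shows "wreath_mat A B \<in> carrier_mat (n * m ^ n) (n * m ^ n)"
proof -
  interpret M: abelian_monoid "module_mat TYPE(complex) (n * m ^ n) (n * m ^ n)"
    using abelian_group_mat abelian_group_def by blast
  have "(\<Oplus>\<^bsub>module_mat TYPE(complex) (n * m ^ n) (n * m ^ n)\<^esub> i\<in>{1..n}.
        1\<^sub>m m ^\<^sub>K (i - 1) \<otimes>\<^sub>K B \<otimes>\<^sub>K 1\<^sub>m m ^\<^sub>K (n - i) \<otimes>\<^sub>K diag_unit_mat n i)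
      \<in> carrier (module_mat TYPE(complex) (n * m ^ n) (n * m ^ n))"
    using wreath_summand_carrier[OF B] by (intro M.finsum_closed) (auto simp: module_mat_simps)
  then show ?thesis
    using A B by (auto simp: wreath_mat_def Let_def module_mat_simps)
qed

lemma equation_summand_carrier:
  assumes A: "A \<in> carrier_mat n n" and B: "B \<in> carrier_mat m m"
    and X: "X \<in> carrier_mat n (m ^ n)" and h: "h \<in> {1..n+1}"
  shows "left_coeff A h * X * right_coeff n B h \<in> carrier_mat n (m ^ n)"
proof -
  have l: "left_coeff A h \<in> carrier_mat n n"
    using A by (auto simp: left_coeff_def diag_unit_mat_def)
  have "right_coeff n B h \<in> carrier_mat (m ^ n) (m ^ n)"
  proof (cases "h = 1")
    case True
    then show ?thesis using B by (auto simp: right_coeff_def intro: kronecker_power_carrier)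
  next
    case False
    then have "h - 2 + 1 + (n + 1 - h) = n" using h by auto
    then have "1\<^sub>m m ^\<^sub>K (h - 2) \<otimes>\<^sub>K B \<otimes>\<^sub>K 1\<^sub>m m ^\<^sub>K (n + 1 - h) \<in> carrier_mat (m ^ n) (m ^ n)"
      using sandwich_carrier[OF B, of "h - 2" "n + 1 - h"] by metis
    then show ?thesis
      using False B by (simp add: right_coeff_def Let_def)
  qed
  with l X show ?thesis by (meson mult_carrier_mat)
qed

end

theory Submission
  imports Defs
begin

text \<open>Stacking the columns of a matrix into a vector turns \<open>X \<mapsto> A * X * B\<close> into multiplication by
  \<open>B\<^sup>T \<otimes> A\<close>. Hence the equation becomes the square linear system whose coefficient matrix is
  \<open>A \<wr> B\<close>, and a square system with a given right-hand side is uniquely solvable iff its matrix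
  has full rank.\<close>

section \<open>Column stacking and Kronecker products\<close>

definition col_stack :: "'a mat \<Rightarrow> 'a vec" where
  "col_stack X = vec (dim_col X * dim_row X) (\<lambda>k. X $$ (k mod dim_row X, k div dim_row X))"

lemma col_stack_carrier: "X \<in> carrier_mat a b \<Longrightarrow> col_stack X \<in> carrier_vec (b * a)"
  by (auto simp: col_stack_def)

lemma col_stack_index:
  "X \<in> carrier_mat a b \<Longrightarrow> k < b * a \<Longrightarrow> col_stack X $ k = X $$ (k mod a, k div a)"
  by (auto simp: col_stack_def)

lemma div_mod_less_mult:
  fixes k a b :: nat
  assumes "k < b * a"
  shows "k div a < b" "k mod a < a"
proof -
  have "0 < a" using assms by (cases a) auto
  then show "k div a < b" "k mod a < a"
    using assms by (auto simp: less_mult_imp_div_less)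
qed

lemma pair_index_less:
  fixes i j a b :: nat
  assumes "i < a" "j < b"
  shows "j * a + i < b * a"
proof -
  have "j * a + i < Suc j * a" using assms(1) by simp
  also have "\<dots> \<le> b * a" using assms(2) by (intro mult_right_mono) auto
  finally show ?thesis .
qed

lemma bij_betw_col_stack: "bij_betw col_stack (carrier_mat a b) (carrier_vec (b * a))"
\<comment> \<open>The inverse unstacks: with \<open>a\<close> rows, entry (i, j) lands at position
  \<open>j * a + i\<close>.\<close>
proof (rule bij_betwI[where g = "\<lambda>v. mat a b (\<lambda>(i, j). v $ (j * a + i))"])
  show "col_stack \<in> carrier_mat a b \<rightarrow> carrier_vec (b * a)"
    by (auto simp: col_stack_carrier)
  show "mat a b (\<lambda>(i, j). col_stack X $ (j * a + i)) = X" if "X \<in> carrier_mat a b" for X :: "'a mat"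
    using that by (intro eq_matI) (auto simp: col_stack_def pair_index_less)
  show "col_stack (mat a b (\<lambda>(i, j). v $ (j * a + i))) = v" if "v \<in> carrier_vec (b * a)"
    for v :: "'a vec"
    using that by (intro eq_vecI) (auto simp: col_stack_def div_mod_less_mult)
qed auto

text \<open>Lets a sum over the positions of a stacked vector run over columns \<open>q\<close> and
  rows \<open>r\<close>, as matrix products need.\<close>

lemma sum_div_mod:
  fixes g :: "nat \<Rightarrow> nat \<Rightarrow> 'a :: comm_monoid_add"
  shows "(\<Sum>l<b * a. g (l div a) (l mod a)) = (\<Sum>q<b. \<Sum>r<a. g q r)"
  unfolding sum.cartesian_product
  by (rule sum.reindex_bij_witness[where i = "\<lambda>(q, r). q * a + r" and j = "\<lambda>l. (l div a, l mod a)"])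
    (auto simp: div_mod_less_mult pair_index_less)

text \<open>With i = \<open>k mod a\<close> and j = \<open>k div a\<close>, both sides at
  \<open>k\<close> are the sum of \<open>A $$ (i, r) * X $$ (r, q) * B $$ (q, j)\<close> over
  \<open>q\<close> and \<open>r\<close>. The quotient of an index selects in the first Kronecker
  factor and the remainder in the second, just as \<open>col_stack\<close> reads off column and row;
  hence \<open>B\<close> comes first, transposed.\<close>

lemma col_stack_mult:
  assumes A: "A \<in> carrier_mat a c" and X: "X \<in> carrier_mat c d" and B: "B \<in> carrier_mat d b"
  shows "col_stack (A * X * B) = (transpose_mat B \<otimes>\<^sub>K A) *\<^sub>v col_stack X"
proof (rule eq_vecI)
  fix k assume "k < dim_vec ((transpose_mat B \<otimes>\<^sub>K A) *\<^sub>v col_stack X)"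
  then have k: "k < b * a" using A B by (simp add: kronecker_def)
  note km = div_mod_less_mult[OF k]
  have "((transpose_mat B \<otimes>\<^sub>K A) *\<^sub>v col_stack X) $ k
      = (\<Sum>l<d * c. B $$ (l div c, k div a) * A $$ (k mod a, l mod c) * X $$ (l mod c, l div c))"
    using A B X k km
    by (auto simp: kronecker_def col_stack_def scalar_prod_def div_mod_less_mult lessThan_atLeast0
        intro!: sum.cong)
  also have "\<dots> = (\<Sum>q<d. \<Sum>r<c. B $$ (q, k div a) * A $$ (k mod a, r) * X $$ (r, q))"
    by (rule sum_div_mod)
  also have "\<dots> = (\<Sum>q<d. (\<Sum>r<c. A $$ (k mod a, r) * X $$ (r, q)) * B $$ (q, k div a))"
    by (simp add: sum_distrib_left sum_distrib_right mult_ac)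
  \<comment> \<open>The inner sum is an entry of \<open>A * X\<close>; \<open>assoc_mult_mat\<close>
    is removed to keep the bracketing \<open>(A * X) * B\<close>.\<close>
  also have "\<dots> = (A * X * B) $$ (k mod a, k div a)"
    using A B X km by (simp add: scalar_prod_def lessThan_atLeast0 del: assoc_mult_mat)
  also have "\<dots> = col_stack (A * X * B) $ k"
    using A B k by (simp add: col_stack_def)
  finally show "col_stack (A * X * B) $ k = ((transpose_mat B \<otimes>\<^sub>K A) *\<^sub>v col_stack X) $ k" ..
qed (use A B in \<open>simp add: kronecker_def col_stack_def\<close>)

section \<open>Entries of matrix sums\<close>

lemma finsum_mat_carrier:
  assumes "\<And>i. i \<in> S \<Longrightarrow> f i \<in> carrier_mat a b"
  shows "(\<Oplus>\<^bsub>module_mat TYPE('a :: comm_ring_1) a b\<^esub> i\<in>S. f i) \<in> carrier_mat a b"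
proof -
  interpret M: abelian_group "module_mat TYPE('a) a b" by (rule abelian_group_mat)
  show ?thesis using M.finsum_closed[of f S] assms by (auto simp: module_mat_simps)
qed

text \<open>Replaces \<open>finsum\<close> by an ordinary sum of scalars, whose order of summation
  can then be exchanged freely.\<close>

lemma finsum_mat_index:
  assumes "finite S" "\<And>i. i \<in> S \<Longrightarrow> f i \<in> carrier_mat a b" "r < a" "s < b"
  shows "(\<Oplus>\<^bsub>module_mat TYPE('a :: comm_ring_1) a b\<^esub> i\<in>S. f i) $$ (r, s) = (\<Sum>i\<in>S. f i $$ (r, s))"
  using assms(1,2)
proof (induction S)
  case empty
  interpret M: abelian_group "module_mat TYPE('a) a b" by (rule abelian_group_mat)
  show ?case using assms(3,4) by (simp add: module_mat_simps)
next
  case (insert x S)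
  interpret M: abelian_group "module_mat TYPE('a) a b" by (rule abelian_group_mat)
  have "(\<Oplus>\<^bsub>module_mat TYPE('a) a b\<^esub> i\<in>insert x S. f i)
      = f x + (\<Oplus>\<^bsub>module_mat TYPE('a) a b\<^esub> i\<in>S. f i)"
    using insert by (subst M.finsum_insert) (auto simp: module_mat_simps)
  moreover have "(\<Oplus>\<^bsub>module_mat TYPE('a) a b\<^esub> i\<in>S. f i) \<in> carrier_mat a b"
    using insert by (intro finsum_mat_carrier) auto
  ultimately show ?case using insert assms(3,4) by simp
qed

lemma kronecker_one: "1\<^sub>m a \<otimes>\<^sub>K 1\<^sub>m b = 1\<^sub>m (a * b)"
proof (rule eq_matI)
  fix i j assume "i < dim_row (1\<^sub>m (a * b) :: complex mat)" "j < dim_col (1\<^sub>m (a * b) :: complex mat)"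
  then have ij: "i < a * b" "j < a * b" by simp_all
  \<comment> \<open>Quotient and remainder determine an index, so the diagonal of the product is
    where both factors are on their diagonals.\<close>
  have "i = j \<longleftrightarrow> i div b = j div b \<and> i mod b = j mod b"
    by (metis div_mult_mod_eq)
  then show "(1\<^sub>m a \<otimes>\<^sub>K 1\<^sub>m b) $$ (i, j) = 1\<^sub>m (a * b) $$ (i, j)"
    using ij by (auto simp: kronecker_def div_mod_less_mult)
qed (auto simp: kronecker_def)

lemma kronecker_power_one: "1\<^sub>m a ^\<^sub>K r = 1\<^sub>m (a ^ r)"
  by (induction r) (simp_all add: kronecker_one mult.commute)

section \<open>The wreath product as coefficient matrix of the stacked equation\<close>

lemma left_coeff_carrier: "A \<in> carrier_mat n n \<Longrightarrow> left_coeff A h \<in> carrier_mat n n"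
  by (auto simp: left_coeff_def diag_unit_mat_def)

lemma right_coeff_carrier:
  assumes B: "B \<in> carrier_mat m m" and h: "h \<in> {1..n + 1}"
  shows "right_coeff n B h \<in> carrier_mat (m ^ n) (m ^ n)"
proof (cases "h = 1")
  case True
  then show ?thesis using B by (simp add: right_coeff_def kronecker_power_one)
next
  case False
  then have "h - 2 + 1 + (n + 1 - h) = n" using h by auto
  then show ?thesis
    using False B sandwich_carrier[OF B, of "h - 2" "n + 1 - h"]
    by (simp add: right_coeff_def Let_def)
qed

lemma wreath_mat_index:
  assumes A: "A \<in> carrier_mat n n" and B: "B \<in> carrier_mat m m"
    and k: "k < n * m ^ n" and l: "l < n * m ^ n"
  shows "wreath_mat A B $$ (k, l)
    = (\<Sum>h\<in>{1..n + 1}. (transpose_mat (right_coeff n B h) \<otimes>\<^sub>K left_coeff A h) $$ (k, l))"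
proof -
  let ?N = "n * m ^ n"
  let ?K = "\<lambda>h. transpose_mat (right_coeff n B h) \<otimes>\<^sub>K left_coeff A h"
  let ?W = "\<lambda>i. 1\<^sub>m m ^\<^sub>K (i - 1) \<otimes>\<^sub>K B \<otimes>\<^sub>K 1\<^sub>m m ^\<^sub>K (n - i) \<otimes>\<^sub>K diag_unit_mat n i"
  have W: "?W i \<in> carrier_mat ?N ?N" if "i \<in> {1..n}" for i
    using wreath_summand_carrier[OF B that] .
  \<comment> \<open>\<open>right_coeff\<close> has no transpose at \<open>h = 1\<close>, but the one
    in \<open>?K\<close> is harmless there: the Kronecker power is an identity matrix.\<close>
  have K1: "?K 1 = 1\<^sub>m m ^\<^sub>K n \<otimes>\<^sub>K A"
    using B by (simp add: right_coeff_def left_coeff_def kronecker_power_one)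
  \<comment> \<open>For \<open>h = Suc i\<close> the two transposes cancel, and the exponents
    \<open>h - 2\<close> and \<open>n + 1 - h\<close> become \<open>i - 1\<close> and
    \<open>n - i\<close>.\<close>
  have KS: "?K (Suc i) = ?W i" if "i \<in> {1..n}" for i
    using A B that by (simp add: right_coeff_def left_coeff_def Let_def)
  have "wreath_mat A B $$ (k, l) = ?K 1 $$ (k, l) + (\<Sum>i\<in>{1..n}. ?W i $$ (k, l))"
  proof -
    let ?F = "\<Oplus>\<^bsub>module_mat TYPE(complex) ?N ?N\<^esub> i\<in>{1..n}. ?W i"
    have "?F \<in> carrier_mat ?N ?N"
      by (rule finsum_mat_carrier) (rule W)
    then have "wreath_mat A B $$ (k, l) = ?K 1 $$ (k, l) + ?F $$ (k, l)"
      using A B k l unfolding K1 by (simp add: wreath_mat_def Let_def)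
    also have "?F $$ (k, l) = (\<Sum>i\<in>{1..n}. ?W i $$ (k, l))"
      by (rule finsum_mat_index[OF _ W k l]) auto
    finally show ?thesis .
  qed
  also have "(\<Sum>i\<in>{1..n}. ?W i $$ (k, l)) = (\<Sum>i\<in>{1..n}. ?K (Suc i) $$ (k, l))"
    by (intro sum.cong refl) (simp only: KS)
  also have "\<dots> = (\<Sum>h\<in>{Suc 1..Suc n}. ?K h $$ (k, l))"
    by (rule sum.shift_bounds_cl_Suc_ivl[symmetric])
  also have "?K 1 $$ (k, l) + \<dots> = (\<Sum>h\<in>{1..n + 1}. ?K h $$ (k, l))"
    by (simp add: sum.atLeast_Suc_atMost)
  finally show ?thesis .
qed

text \<open>By \<open>col_stack_mult\<close>, each summand of the equation acts on the stacked
  unknown as one Kronecker product; by \<open>wreath_mat_index\<close> these products add up to the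
  wreath product.\<close>

lemma col_stack_equation:
  assumes A: "A \<in> carrier_mat n n" and B: "B \<in> carrier_mat m m" and X: "X \<in> carrier_mat n (m ^ n)"
  shows "col_stack (\<Oplus>\<^bsub>module_mat TYPE(complex) n (m ^ n)\<^esub> h\<in>{1..n + 1}.
      left_coeff A h * X * right_coeff n B h) = wreath_mat A B *\<^sub>v col_stack X"
    (is "col_stack ?S = _")
proof (rule eq_vecI)
  let ?N = "n * m ^ n"
  let ?K = "\<lambda>h. transpose_mat (right_coeff n B h) \<otimes>\<^sub>K left_coeff A h"
  let ?Y = "\<lambda>h. left_coeff A h * X * right_coeff n B h"
  have Y: "?Y h \<in> carrier_mat n (m ^ n)" if "h \<in> {1..n + 1}" for h
    using equation_summand_carrier[OF A B X that] .
  have S: "?S \<in> carrier_mat n (m ^ n)"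
    by (rule finsum_mat_carrier) (rule Y)
  have x: "col_stack X \<in> carrier_vec ?N"
    using col_stack_carrier[OF X] by (simp add: mult.commute)
  have W: "wreath_mat A B \<in> carrier_mat ?N ?N"
    by (rule wreath_mat_carrier[OF A B])
  have K: "?K h \<in> carrier_mat ?N ?N" if "h \<in> {1..n + 1}" for h
    using kronecker_carrier[of "transpose_mat (right_coeff n B h)" "m ^ n" "m ^ n" "left_coeff A h" n n]
      left_coeff_carrier[OF A] right_coeff_carrier[OF B that] by (simp add: mult.commute)
  show "dim_vec (col_stack ?S) = dim_vec (wreath_mat A B *\<^sub>v col_stack X)"
    using S W by (simp add: col_stack_def)
  fix k assume "k < dim_vec (wreath_mat A B *\<^sub>v col_stack X)"
  then have k: "k < ?N" using W by simp
  then have k': "k < m ^ n * n" by (simp add: mult.commute)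
  note km = div_mod_less_mult[OF k']
  have "col_stack ?S $ k = ?S $$ (k mod n, k div n)"
    by (rule col_stack_index[OF S k'])
  also have "\<dots> = (\<Sum>h\<in>{1..n + 1}. ?Y h $$ (k mod n, k div n))"
    by (rule finsum_mat_index) (use Y km in auto)
  also have "\<dots> = (\<Sum>h\<in>{1..n + 1}. (?K h *\<^sub>v col_stack X) $ k)"
  proof (rule sum.cong)
    fix h assume h: "h \<in> {1..n + 1}"
    have "?Y h $$ (k mod n, k div n) = col_stack (?Y h) $ k"
      by (rule col_stack_index[OF Y[OF h] k', symmetric])
    then show "?Y h $$ (k mod n, k div n) = (?K h *\<^sub>v col_stack X) $ k"
      using col_stack_mult[OF left_coeff_carrier[OF A] X right_coeff_carrier[OF B h]] by simp
  qed simp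
  also have "\<dots> = (\<Sum>h\<in>{1..n + 1}. \<Sum>l<?N. ?K h $$ (k, l) * col_stack X $ l)"
  proof (rule sum.cong)
    fix h assume h: "h \<in> {1..n + 1}"
    show "(?K h *\<^sub>v col_stack X) $ k = (\<Sum>l<?N. ?K h $$ (k, l) * col_stack X $ l)"
      using carrier_matD[OF K[OF h]] k carrier_vecD[OF x]
      by (simp add: scalar_prod_def lessThan_atLeast0)
  qed simp
  \<comment> \<open>Exchanging the sums collects the coefficient of each entry of the
    unknown.\<close>
  also have "\<dots> = (\<Sum>l<?N. (\<Sum>h\<in>{1..n + 1}. ?K h $$ (k, l)) * col_stack X $ l)"
    by (subst sum.swap) (simp only: sum_distrib_right)
  also have "\<dots> = (\<Sum>l<?N. wreath_mat A B $$ (k, l) * col_stack X $ l)"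
    by (intro sum.cong refl) (simp only: wreath_mat_index[OF A B k] lessThan_iff)
  also have "\<dots> = (wreath_mat A B *\<^sub>v col_stack X) $ k"
    using carrier_matD[OF W] k carrier_vecD[OF x] by (simp add: scalar_prod_def lessThan_atLeast0)
  finally show "col_stack ?S $ k = (wreath_mat A B *\<^sub>v col_stack X) $ k" .
qed

section \<open>Unique solvability of square systems and its transfer to matrices\<close>

lemma unique_solution_iff_full_rank:
  fixes W :: "'a :: field mat"
  assumes W: "W \<in> carrier_mat N N" and c: "c \<in> carrier_vec N"
  shows "(\<exists>!x. x \<in> carrier_vec N \<and> W *\<^sub>v x = c) \<longleftrightarrow> vec_space.rank N W = N"
proof -
  \<comment> \<open>The determinant mediates. If it vanishes, adding a nonzero kernel vector to the
    solution gives a second one, so uniqueness for the single given \<open>c\<close> suffices;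
    otherwise the inverse gives the solution.\<close>
  have "(\<exists>!x. x \<in> carrier_vec N \<and> W *\<^sub>v x = c) \<longleftrightarrow> det W \<noteq> 0"
  proof
    assume ex1: "\<exists>!x. x \<in> carrier_vec N \<and> W *\<^sub>v x = c"
    then obtain x where x: "x \<in> carrier_vec N" "W *\<^sub>v x = c" by blast
    show "det W \<noteq> 0"
    proof
      assume "det W = 0"
      then obtain v where v: "v \<in> carrier_vec N" "v \<noteq> 0\<^sub>v N" "W *\<^sub>v v = 0\<^sub>v N"
        using det_0_iff_vec_prod_zero_field[OF W] by blast
      have "W *\<^sub>v (x + v) = c"
        using mult_add_distrib_mat_vec[OF W x(1) v(1)] x(2) v(3) c by simp
      then have "x + v = x" using ex1 x v(1) by (metis add_carrier_vec)
      then have "v = 0\<^sub>v N"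
        using x(1) v(1) by (auto simp: vec_eq_iff)
      with v(2) show False ..
    qed
  next
    assume "det W \<noteq> 0"
    \<comment> \<open>The argument \<open>()\<close> only fills the record extension slot of
      \<open>ring_mat\<close>.\<close>
    from det_non_zero_imp_unit[OF W this, of "()"] obtain V
      where V: "V \<in> carrier_mat N N" and VW: "V * W = 1\<^sub>m N" and WV: "W * V = 1\<^sub>m N"
      by (auto simp: Units_def ring_mat_def)
    show "\<exists>!x. x \<in> carrier_vec N \<and> W *\<^sub>v x = c"
    proof (rule ex1I[where a = "V *\<^sub>v c"])
      show "V *\<^sub>v c \<in> carrier_vec N \<and> W *\<^sub>v (V *\<^sub>v c) = c"
        using V c WV assoc_mult_mat_vec[OF W V c] by auto
      fix x assume "x \<in> carrier_vec N \<and> W *\<^sub>v x = c"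
      then show "x = V *\<^sub>v c"
        using assoc_mult_mat_vec[OF V W, of x] VW by auto
    qed
  qed
  also have "\<dots> \<longleftrightarrow> vec_space.rank N W = N"
    by (rule vec_space.det_rank_iff[OF W])
  finally show ?thesis .
qed

lemma bij_betw_ex1_iff:
  assumes "bij_betw f S T"
  shows "(\<exists>!x. x \<in> S \<and> P (f x)) \<longleftrightarrow> (\<exists>!y. y \<in> T \<and> P y)"
  using assms unfolding bij_betw_def inj_on_def by (smt (verit) image_iff)

theorem proposition6p2:
  fixes n m :: nat and A B C :: "complex mat"
  assumes "n \<ge> 1" and "m \<ge> 1"
    and "A \<in> carrier_mat n n"
    and "B \<in> carrier_mat m m"
    and "C \<in> carrier_mat n (m ^ n)"
  shows "(\<exists>!X. X \<in> carrier_mat n (m ^ n) \<and>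
            (\<Oplus>\<^bsub>module_mat TYPE(complex) n (m ^ n)\<^esub> i\<in>{1..n+1}.
               left_coeff A i * X * right_coeff n B i) = C)
         \<longleftrightarrow> vec_space.rank (n * m ^ n) (wreath_mat A B) = n * m ^ n"
proof -
  note A = assms(3) and B = assms(4) and C = assms(5)
  let ?S = "\<lambda>X. \<Oplus>\<^bsub>module_mat TYPE(complex) n (m ^ n)\<^esub> i\<in>{1..n+1}.
    left_coeff A i * X * right_coeff n B i"
  have bij: "bij_betw col_stack (carrier_mat n (m ^ n)) (carrier_vec (n * m ^ n) :: complex vec set)"
    using bij_betw_col_stack[of n "m ^ n"] by (simp add: mult.commute)
  have c: "col_stack C \<in> carrier_vec (n * m ^ n)"
    using col_stack_carrier[OF C] by (simp add: mult.commute)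
  have "?S X = C \<longleftrightarrow> wreath_mat A B *\<^sub>v col_stack X = col_stack C"
    if X: "X \<in> carrier_mat n (m ^ n)" for X
  proof -
    \<comment> \<open>Stacking is injective only among matrices of a fixed shape, so the sum must be
      known to have the shape of \<open>C\<close>.\<close>
    have "?S X \<in> carrier_mat n (m ^ n)"
      by (rule finsum_mat_carrier) (rule equation_summand_carrier[OF A B X])
    then have "?S X = C \<longleftrightarrow> col_stack (?S X) = col_stack C"
      using bij_betw_imp_inj_on[OF bij] C by (auto dest: inj_onD)
    then show ?thesis by (simp only: col_stack_equation[OF A B X])
  qed
  then have "(\<exists>!X. X \<in> carrier_mat n (m ^ n) \<and> ?S X = C)
    \<longleftrightarrow> (\<exists>!X. X \<in> carrier_mat n (m ^ n) \<and> wreath_mat A B *\<^sub>v col_stack X = col_stack C)"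
    \<comment> \<open>The two predicates are equal as functions: the carrier condition in both
      supplies what the pointwise equivalence assumes.\<close>
    by (intro arg_cong[where f = Ex1] ext) blast
  also have "\<dots> \<longleftrightarrow> (\<exists>!x. x \<in> carrier_vec (n * m ^ n) \<and> wreath_mat A B *\<^sub>v x = col_stack C)"
    by (rule bij_betw_ex1_iff[OF bij])
  also have "\<dots> \<longleftrightarrow> vec_space.rank (n * m ^ n) (wreath_mat A B) = n * m ^ n"
    by (rule unique_solution_iff_full_rank[OF wreath_mat_carrier[OF A B] c])
  finally show ?thesis .
qed

end
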